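(* Let $n\ge 2$, $\zeta=e^{2i\pi/n}$, and let $G=\langle\sigma\rangle$ be the cyclic group of order $n$ acting by algebra automorphisms on $S=\mathbb{C}[x_1,x_2,y_1,y_2]$ by $\sigma x_1=\zeta x_1$, $\sigma x_2=\zeta x_2$, $\sigma y_1=\zeta^{n-1}y_1$, $\sigma y_2=\zeta^{n-1}y_2$. Then $\dim_{\mathbb{C}} HP_0(S^G)=n-1$.
   Context: $S$ carries the standard Poisson bracket: $\{x_i,y_j\}=\delta_{ij}$, $\{x_i,x_j\}=\{y_i,y_j\}=0$. $G$ acts by Poisson automorphisms, so the invariant algebra $S^G$ is a Poisson subalgebra. $HP_0(S^G)=S^G/\{S^G,S^G\}$, where $\{S^G,S^G\}$ is the linear span of all brackets of elements of $S^G$. *)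

theory Defs
  imports
    "HOL-Algebra.Bij"
    "HOL-Algebra.Generated_Groups"
    "HOL-Algebra.AbelCoset"
    "HOL-Analysis.Complex_Transcendental"
    "Jordan_Normal_Form.VS_Connect"
    "HOL-Library.Poly_Mapping"
begin

hide_const (open) Multiset.mult

section \<open>The polynomial algebra \<open>S = \<complex>[x\<^sub>1,x\<^sub>2,y\<^sub>1,y\<^sub>2]\<close>\<close>

datatype coord = X1 | X2 | Y1 | Y2

text \<open>A polynomial maps each monomial, i.e. each exponent function \<open>coord \<Rightarrow>\<^sub>0 nat\<close>, to its
  coefficient; the ring structure is the convolution product of \<open>Poly_Mapping\<close>.\<close>

type_synonym monom = "coord \<Rightarrow>\<^sub>0 nat"
type_synonym S = "monom \<Rightarrow>\<^sub>0 complex"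

definition Const :: "complex \<Rightarrow> S" where
  "Const c = Poly_Mapping.single 0 c"

definition Var :: "coord \<Rightarrow> S" where
  "Var v = Poly_Mapping.single (Poly_Mapping.single v 1) 1"

definition subst :: "(coord \<Rightarrow> S) \<Rightarrow> S \<Rightarrow> S" where
  "subst f p = (\<Sum>m\<in>Poly_Mapping.keys p. Const (Poly_Mapping.lookup p m) * (\<Prod>v\<in>Poly_Mapping.keys m. f v ^ Poly_Mapping.lookup m v))"

text \<open>In \<open>partial\<close>, the subtraction of exponents truncates only when the factor
  \<open>Poly_Mapping.lookup m v\<close> is \<open>0\<close>.\<close>

definition partial :: "coord \<Rightarrow> S \<Rightarrow> S" where
  "partial v p =
     (\<Sum>m\<in>Poly_Mapping.keys p. Poly_Mapping.single (m - Poly_Mapping.single v 1) (of_nat (Poly_Mapping.lookup m v) * Poly_Mapping.lookup p m))"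

definition poisson :: "S \<Rightarrow> S \<Rightarrow> S" where
  "poisson f g =
     (partial X1 f * partial Y1 g - partial Y1 f * partial X1 g) +
     (partial X2 f * partial Y2 g - partial Y2 f * partial X2 g)"

definition S_space :: "(complex, S) module" where
  "S_space = \<lparr>carrier = UNIV, mult = (*), one = 1, zero = 0, add = (+), smult = (\<lambda>c p. Const c * p)\<rparr>"


section \<open>The group and its invariants\<close>

definition zeta :: "nat \<Rightarrow> complex" where
  "zeta n = exp (2 * \<i> * of_real pi / of_nat n)"

fun sigma_gen :: "nat \<Rightarrow> coord \<Rightarrow> S" where
  "sigma_gen n X1 = Const (zeta n) * Var X1"
| "sigma_gen n X2 = Const (zeta n) * Var X2"
| "sigma_gen n Y1 = Const (zeta n ^ (n - 1)) * Var Y1"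
| "sigma_gen n Y2 = Const (zeta n ^ (n - 1)) * Var Y2"

definition sigma :: "nat \<Rightarrow> S \<Rightarrow> S" where
  "sigma n = subst (sigma_gen n)"

definition group_G :: "nat \<Rightarrow> (S \<Rightarrow> S) set" where
  "group_G n = generate (BijGroup UNIV) {sigma n}"

definition S_inv :: "nat \<Rightarrow> S set" where
  "S_inv n = {p. \<forall>g\<in>group_G n. g p = p}"

abbreviation S_inv_space :: "nat \<Rightarrow> (complex, S) module" where
  "S_inv_space n \<equiv> S_space\<lparr>carrier := S_inv n\<rparr>"


section \<open>Zeroth Poisson homology\<close>

text \<open>The record type of modules extends that of rings, but \<open>module\<close> and \<open>vectorspace\<close> do not
  refer to the fields \<open>mult\<close> and \<open>one\<close>, which are meaningless for a quotient by a subspace.\<close>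

definition quotient_module :: "('a, 'b, 'c) module_scheme \<Rightarrow> 'b set \<Rightarrow> ('a, 'b set) module" where
  "quotient_module M N =
     \<lparr>carrier = a_rcosets\<^bsub>M\<^esub> N, mult = undefined, one = undefined,
      zero = N, add = set_add M, smult = (\<lambda>c A. \<Union>a\<in>A. N +>\<^bsub>M\<^esub> (c \<odot>\<^bsub>M\<^esub> a))\<rparr>"

definition brackets :: "nat \<Rightarrow> S set" where
  "brackets n =
     LinearCombinations.module.span class_ring (S_inv_space n)
       {poisson f g | f g. f \<in> S_inv n \<and> g \<in> S_inv n}"

definition HP0 :: "nat \<Rightarrow> (complex, S set) module" where
  "HP0 n = quotient_module (S_inv_space n) (brackets n)"


section \<open>The bracket and the action are the intended ones\<close>

text \<open>\<open>poisson\<close> is the Poisson bracket with the prescribed values on the generators, \<open>sigma\<close> is the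
  algebra endomorphism with the prescribed values on the generators, and \<open>group_G\<close> is cyclic of
  order \<open>n\<close>.\<close>

lemma S_induct [case_names single add]:
  assumes "\<And>m c. P (Poly_Mapping.single m c)" "\<And>p q. P p \<Longrightarrow> P q \<Longrightarrow> P (p + q)"
  shows "P (p :: S)"
proof (induction p rule: update_induct)
  case const
  show ?case using assms(1)[of 0 0] by simp
next
  case (update p m c)
  have "Poly_Mapping.update m c p = p + Poly_Mapping.single m c"
    using update by (intro poly_mapping_eqI) (auto simp: lookup_update lookup_add lookup_single in_keys_iff)
  then show ?case using assms update by simp
qed

lemma sum_keys_add:
  fixes h :: "monom \<Rightarrow> complex \<Rightarrow> S"
  assumes "\<And>m. h m 0 = 0" "\<And>m a b. h m (a + b) = h m a + h m b"
  shows "(\<Sum>m\<in>Poly_Mapping.keys (p + q). h m (Poly_Mapping.lookup (p + q) m)) =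
         (\<Sum>m\<in>Poly_Mapping.keys p. h m (Poly_Mapping.lookup p m)) +
         (\<Sum>m\<in>Poly_Mapping.keys q. h m (Poly_Mapping.lookup q m))"
proof -
  let ?A = "Poly_Mapping.keys p \<union> Poly_Mapping.keys q"
  have *: "(\<Sum>m\<in>Poly_Mapping.keys r. h m (Poly_Mapping.lookup r m)) = (\<Sum>m\<in>?A. h m (Poly_Mapping.lookup r m))"
    if "Poly_Mapping.keys r \<subseteq> ?A" for r
    by (rule sum.mono_neutral_left) (use that assms(1) in \<open>auto simp: in_keys_iff\<close>)
  show ?thesis
    using *[of p] *[of q] *[of "p + q"] Poly_Mapping.keys_add[of p q]
    by (simp add: sum.distrib lookup_add assms(2))
qed

lemma Const_simps [simp]:
  "Const 0 = 0" "Const 1 = 1" "Const (a + b) = Const a + Const b" "Const (a * b) = Const a * Const b"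
  by (simp_all add: Const_def single_add mult_single)

lemma partial_single:
  "partial v (Poly_Mapping.single m c) =
     Poly_Mapping.single (m - Poly_Mapping.single v 1) (of_nat (Poly_Mapping.lookup m v) * c)"
  by (cases "c = 0") (simp_all add: partial_def)

lemma partial_add: "partial v (p + q) = partial v p + partial v q"
  unfolding partial_def
  by (rule sum_keys_add[where h = "\<lambda>m c. Poly_Mapping.single (m - Poly_Mapping.single v 1) (of_nat (Poly_Mapping.lookup m v) * c)"])
     (simp_all add: algebra_simps single_add)

lemma partial_mult: "partial v (p * q) = p * partial v q + partial v p * q"
proof (induction p rule: S_induct)
  case (single m c)
  show ?case
  proof (induction q rule: S_induct)
    case (single m' c')
    let ?e = "Poly_Mapping.single v (1::nat)"
    have 1: "m + m' - ?e = m + (m' - ?e)" if "Poly_Mapping.lookup m' v \<noteq> 0"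
      using that by (intro poly_mapping_eqI) (auto simp: lookup_add lookup_minus lookup_single when_def)
    have 2: "m + m' - ?e = (m - ?e) + m'" if "Poly_Mapping.lookup m v \<noteq> 0"
      using that by (intro poly_mapping_eqI) (auto simp: lookup_add lookup_minus lookup_single when_def)
    show ?case
      using 1 2
      by (cases "Poly_Mapping.lookup m v = 0"; cases "Poly_Mapping.lookup m' v = 0")
         (simp_all add: partial_single mult_single lookup_add algebra_simps single_add[symmetric])
  next
    case (add p q)
    then show ?case by (simp add: partial_add algebra_simps)
  qed
next
  case (add p q)
  then show ?case by (simp add: partial_add algebra_simps)
qed

lemma partial_Const [simp]: "partial v (Const c) = 0"
  by (simp add: Const_def partial_single)

lemma partial_Var [simp]: "partial v (Var w) = (if v = w then 1 else 0)"
  by (simp add: Var_def partial_single lookup_single)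

lemma partial_commute: "partial v (partial w p) = partial w (partial v p)"
proof (induction p rule: S_induct)
  case (single m c)
  have "m - Poly_Mapping.single v 1 - Poly_Mapping.single w 1 = m - Poly_Mapping.single w 1 - Poly_Mapping.single v (1::nat)"
    by (intro poly_mapping_eqI) (auto simp: lookup_minus)
  then show ?case
    by (cases "v = w") (simp_all add: partial_single lookup_minus lookup_single algebra_simps)
next
  case (add p q)
  then show ?case by (simp add: partial_add)
qed

lemma partial_uminus: "partial v (- p) = - partial v p"
proof -
  have "partial v (- p) + partial v p = 0"
    using partial_Const[of v 0] by (simp flip: partial_add)
  then show ?thesis by (simp add: eq_neg_iff_add_eq_0)
qed

lemma partial_diff: "partial v (p - q) = partial v p - partial v q"
  using partial_add[of v p "- q"] by (simp add: partial_uminus)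

lemma poisson_generators:
  "poisson (Var X1) (Var Y1) = 1" "poisson (Var X2) (Var Y2) = 1"
  "poisson (Var X1) (Var Y2) = 0" "poisson (Var X2) (Var Y1) = 0"
  "poisson (Var X1) (Var X2) = 0" "poisson (Var Y1) (Var Y2) = 0"
  by (simp_all add: poisson_def)

lemma poisson_antisym: "poisson f g = - poisson g f"
  by (simp add: poisson_def algebra_simps)

lemma poisson_add: "poisson f (g + h) = poisson f g + poisson f h"
  by (simp add: poisson_def partial_add algebra_simps)

lemma poisson_Const: "poisson f (Const c * g) = Const c * poisson f g"
  by (simp add: poisson_def partial_mult algebra_simps)

lemma poisson_Leibniz: "poisson f (g * h) = poisson f g * h + g * poisson f h"
  by (simp add: poisson_def partial_mult algebra_simps)

lemma poisson_Jacobi: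
  "poisson f (poisson g h) + poisson g (poisson h f) + poisson h (poisson f g) = 0"
  by (simp add: poisson_def partial_mult partial_add partial_diff algebra_simps
      partial_commute[of Y1 X1] partial_commute[of X2 X1] partial_commute[of Y2 X1]
      partial_commute[of X2 Y1] partial_commute[of Y2 Y1] partial_commute[of Y2 X2])

lemma coord_UNIV: "UNIV = {X1, X2, Y1, Y2}"
  using coord.exhaust by blast

instance coord :: finite
  by standard (simp add: coord_UNIV)

lemma subst_alt:
  "subst f p = (\<Sum>m\<in>Poly_Mapping.keys p. Const (Poly_Mapping.lookup p m) * (\<Prod>v\<in>UNIV. f v ^ Poly_Mapping.lookup m v))"
  unfolding subst_def
  by (intro sum.cong refl arg_cong2[where f = "(*)"] prod.mono_neutral_left) (auto simp: in_keys_iff)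

lemma subst_single:
  "subst f (Poly_Mapping.single m c) = Const c * (\<Prod>v\<in>UNIV. f v ^ Poly_Mapping.lookup m v)"
  by (cases "c = 0") (simp_all add: subst_alt)

lemma subst_add: "subst f (p + q) = subst f p + subst f q"
  unfolding subst_alt
  by (rule sum_keys_add[where h = "\<lambda>m c. Const c * (\<Prod>v\<in>UNIV. f v ^ Poly_Mapping.lookup m v)"])
     (simp_all add: algebra_simps)

lemma subst_mult: "subst f (p * q) = subst f p * subst f q"
proof (induction p rule: S_induct)
  case (single m c)
  show ?case
  proof (induction q rule: S_induct)
    case (single m' c')
    show ?case
      by (simp add: mult_single subst_single lookup_add power_add prod.distrib algebra_simps)
  next
    case (add p q)
    then show ?case by (simp add: subst_add algebra_simps)
  qed
next
  case (add p q)
  then show ?case by (simp add: subst_add algebra_simps)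
qed

lemma subst_Const [simp]: "subst f (Const c) = Const c"
  using subst_single[of f 0 c] by (simp add: Const_def)

lemma subst_Var [simp]: "subst f (Var v) = f v"
proof -
  have "(\<Prod>w\<in>UNIV. f w ^ Poly_Mapping.lookup (Poly_Mapping.single v 1) w) = (\<Prod>w\<in>UNIV. if v = w then f v else 1)"
    by (intro prod.cong) (auto simp: lookup_single when_def)
  then show ?thesis by (simp add: Var_def subst_single)
qed

lemma subst_power: "subst f (p ^ k) = subst f p ^ k"
  using subst_Const[of f 1] by (induction k) (simp_all add: subst_mult)

lemma subst_prod: "subst f (\<Prod>a\<in>A. h a) = (\<Prod>a\<in>A. subst f (h a))"
  using subst_Const[of f 1] by (induction A rule: infinite_finite_induct) (simp_all add: subst_mult)

lemma subst_subst: "subst f (subst g p) = subst (\<lambda>v. subst f (g v)) p"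
proof (induction p rule: S_induct)
  case (single m c)
  show ?case by (simp add: subst_single subst_mult subst_prod subst_power)
next
  case (add p q)
  then show ?case by (simp add: subst_add)
qed

lemma subst_id: "subst Var p = p"
proof (induction p rule: S_induct)
  case (single m c)
  have *: "Var v ^ k = Poly_Mapping.single (Poly_Mapping.single v k) 1" for v k
    by (induction k) (simp_all add: Var_def mult_single flip: single_add)
  have **: "(\<Prod>v\<in>A. Poly_Mapping.single (h v) (1::complex)) = Poly_Mapping.single (\<Sum>v\<in>A. h v) 1"
    if "finite A" for A :: "coord set" and h :: "coord \<Rightarrow> monom"
    using that by (induction A rule: finite_induct) (simp_all add: mult_single)
  have "(\<Sum>v\<in>UNIV. Poly_Mapping.single v (Poly_Mapping.lookup m v)) = m"
    by (intro poly_mapping_eqI) (simp add: lookup_sum lookup_single when_def)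
  then show ?case by (simp add: subst_single * ** Const_def mult_single)
next
  case (add p q)
  then show ?case by (simp add: subst_add)
qed

lemma zeta_power_eq_1_iff:
  assumes n: "n > 0"
  shows "zeta n ^ k = 1 \<longleftrightarrow> n dvd k"
proof -
  have "zeta n ^ k = exp (of_nat k * (2 * \<i> * of_real pi / of_nat n))"
    unfolding zeta_def by (rule exp_of_nat_mult[symmetric])
  also have "\<dots> = 1 \<longleftrightarrow> (\<exists>j::int. real k / real n = of_int j)"
  proof -
    have "of_nat k * (2 * \<i> * of_real pi / of_nat n) = \<i> * of_real (2 * pi * (real k / real n))"
      by simp
    moreover have "2 * pi * (real k / real n) = of_int (2 * j) * pi \<longleftrightarrow> real k / real n = of_int j" for j :: int
      using mult_cancel_left[of "2 * pi" "real k / real n" "of_int j"] by (simp only: of_int_mult mult_ac) simp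
    ultimately show ?thesis
      unfolding exp_eq_1 by (simp only: Re_i_times Im_i_times Re_complex_of_real Im_complex_of_real) simp
  qed
  also have "\<dots> \<longleftrightarrow> n dvd k"
  proof
    assume "\<exists>j::int. real k / real n = of_int j"
    then obtain j :: int where "real k / real n = of_int j" ..
    then have "real_of_int (int k) = real_of_int (int n * j)"
      using n by (simp add: field_simps)
    then have "int k = int n * j"
      by (simp only: of_int_eq_iff)
    then show "n dvd k"
      by (metis dvd_triv_left int_dvd_int_iff)
  next
    assume "n dvd k"
    then obtain i where "k = n * i" ..
    then show "\<exists>j::int. real k / real n = of_int j"
      using n by (intro exI[of _ "int i"]) simp
  qed
  finally show ?thesis .
qed

lemma sigma_pow:
  "(sigma n ^^ k) = subst (\<lambda>v. Const ((if v \<in> {X1, X2} then zeta n else zeta n ^ (n - 1)) ^ k) * Var v)"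
proof (induction k)
  case 0
  show ?case by (auto simp: subst_id)
next
  case (Suc k)
  have gen: "sigma_gen n v = Const (if v \<in> {X1, X2} then zeta n else zeta n ^ (n - 1)) * Var v" for v
    by (cases v) auto
  show ?case
    by (rule ext, simp only: funpow.simps Suc o_apply, simp only: sigma_def subst_subst)
       (simp only: subst_mult subst_Const subst_Var gen power_Suc Const_simps mult_ac)
qed

lemma sigma_order: "n > 0 \<Longrightarrow> sigma n ^^ k = id \<longleftrightarrow> n dvd k"
proof
  assume n: "n > 0" and id: "sigma n ^^ k = id"
  then have "Const (zeta n ^ k) * Var X1 = Var X1"
    using fun_cong[OF sigma_pow[of k n], of "Var X1"] by simp
  then have "Poly_Mapping.lookup (Const (zeta n ^ k) * Var X1) (Poly_Mapping.single X1 1) = 1"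
    by (simp add: Var_def)
  then show "n dvd k"
    using n by (simp add: Const_def Var_def mult_single zeta_power_eq_1_iff)
next
  assume n: "n > 0" and k: "n dvd k"
  have "zeta n ^ k = 1" "(zeta n ^ (n - 1)) ^ k = 1"
    using n k by (simp_all add: zeta_power_eq_1_iff flip: power_mult)
  then have *: "(if v \<in> {X1, X2} then zeta n else zeta n ^ (n - 1)) ^ k = 1" for v
    by simp
  show "sigma n ^^ k = id"
    unfolding sigma_pow * by (auto simp: subst_id)
qed

lemma sigma_funpow_less:
  assumes "n > 0"
  shows "sigma n ^^ k = sigma n ^^ (k mod n)"
proof -
  have "sigma n ^^ k = sigma n ^^ (n * (k div n)) \<circ> sigma n ^^ (k mod n)"
    by (simp flip: funpow_add)
  moreover have "sigma n ^^ (n * (k div n)) = id"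
    using assms by (simp add: sigma_order)
  ultimately show ?thesis
    by simp
qed

lemma sigma_bij:
  assumes "n > 0"
  shows "bij (sigma n)"
proof (rule o_bij)
  have "sigma n ^^ n = id"
    using assms by (simp add: sigma_order)
  then have *: "sigma n ^^ Suc (n - 1) = id"
    using assms by simp
  then show "(sigma n ^^ (n - 1)) \<circ> sigma n = id"
    by (simp only: funpow_Suc_right)
  show "sigma n \<circ> (sigma n ^^ (n - 1)) = id"
    using * by simp
qed

lemma group_G_eq:
  assumes n: "n > 0"
  shows "group_G n = (\<lambda>k. sigma n ^^ k) ` {..<n}"
proof -
  have carr: "f \<in> carrier (BijGroup UNIV) \<longleftrightarrow> bij f" for f :: "S \<Rightarrow> S"
    by (simp add: BijGroup_def Bij_def)
  have mult: "g \<otimes>\<^bsub>BijGroup UNIV\<^esub> f = g \<circ> f" if "bij f" "bij g" for f g :: "S \<Rightarrow> S"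
    using that by (simp add: BijGroup_def Bij_def compose_def fun_eq_iff)
  have one: "\<one>\<^bsub>BijGroup UNIV\<^esub> = (id :: S \<Rightarrow> S)"
    by (simp add: BijGroup_def fun_eq_iff)
  interpret B: group "BijGroup (UNIV :: S set)"
    by (rule group_BijGroup)
  have bij: "bij (sigma n ^^ k)" for k
    by (rule bij_fn[OF sigma_bij[OF n]])
  have less: "sigma n ^^ k \<in> (\<lambda>k. sigma n ^^ k) ` {..<n}" for k
    using sigma_funpow_less[OF n, of k] n by force
  have inv: "inv\<^bsub>BijGroup UNIV\<^esub> (sigma n) = sigma n ^^ (n - 1)"
  proof (rule B.inv_equality)
    have "sigma n ^^ Suc (n - 1) = id"
      using n by (simp add: sigma_order)
    then show "(sigma n ^^ (n - 1)) \<otimes>\<^bsub>BijGroup UNIV\<^esub> sigma n = \<one>\<^bsub>BijGroup UNIV\<^esub>"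
      unfolding mult[OF sigma_bij[OF n] bij] one by (simp only: funpow_Suc_right)
  qed (simp_all add: carr bij sigma_bij[OF n])
  show ?thesis
  proof (intro equalityI subsetI)
    fix g assume "g \<in> group_G n"
    then show "g \<in> (\<lambda>k. sigma n ^^ k) ` {..<n}"
      unfolding group_G_def
    proof (induction rule: generate.induct)
      case one
      then show ?case using less[of 0] by (simp add: \<open>\<one>\<^bsub>BijGroup UNIV\<^esub> = id\<close> id_def)
    next
      case (incl h)
      then show ?case using less[of 1] by simp
    next
      case (inv h)
      then show ?case using less[of "n - 1"] by (simp add: \<open>inv\<^bsub>BijGroup UNIV\<^esub> (sigma n) = _\<close>)
    next
      case (eng h1 h2)
      then obtain i j where "h1 = sigma n ^^ i" "h2 = sigma n ^^ j" by blast
      then show ?case using less[of "i + j"] by (simp only: mult bij funpow_add)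
    qed
  next
    fix g assume "g \<in> (\<lambda>k. sigma n ^^ k) ` {..<n}"
    then obtain k where g: "g = sigma n ^^ k" by blast
    have "sigma n ^^ k \<in> generate (BijGroup UNIV) {sigma n}"
    proof (induction k)
      case 0
      show ?case using generate.one[of "BijGroup UNIV" "{sigma n}"] by (simp add: one id_def)
    next
      case (Suc k)
      have "sigma n \<in> generate (BijGroup UNIV) {sigma n}"
        by (rule generate.incl) simp
      from generate.eng[OF this Suc] show ?case
        by (simp only: mult[OF bij sigma_bij[OF n]] funpow.simps)
    qed
    then show "g \<in> group_G n" by (simp add: g group_G_def)
  qed
qed

lemma card_group_G:
  assumes n: "n > 0"
  shows "card (group_G n) = n"
proof -
  have aux: "i = j" if "i \<le> j" "j < n" "sigma n ^^ i = sigma n ^^ j" for i j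
  proof -
    have "sigma n ^^ i \<circ> sigma n ^^ (j - i) = sigma n ^^ i \<circ> id"
      unfolding funpow_add[symmetric] o_id using that by (simp only: le_add_diff_inverse)
    note comp = this
    have "sigma n ^^ (j - i) = id"
    proof
      fix x
      have "(sigma n ^^ i) ((sigma n ^^ (j - i)) x) = (sigma n ^^ i) (id x)"
        using fun_cong[OF comp, of x] by (simp only: o_apply)
      then show "(sigma n ^^ (j - i)) x = id x"
        by (rule injD[OF bij_is_inj[OF bij_fn[OF sigma_bij[OF n]]]])
    qed
    then have "n dvd j - i"
      using n by (simp add: sigma_order)
    then show "i = j"
      using that by (auto dest: dvd_imp_le)
  qed
  have "inj_on (\<lambda>k. sigma n ^^ k) {..<n}"
  proof (rule inj_onI)
    fix i j
    assume "i \<in> {..<n}" "j \<in> {..<n}" "sigma n ^^ i = sigma n ^^ j"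
    then show "i = j"
      using aux[of i j] aux[of j i] nat_le_linear[of i j] by (metis lessThan_iff)
  qed
  then show ?thesis
    by (simp add: group_G_eq[OF n] card_image)
qed

lemma sigma_alg_hom:
  "sigma n (p + q) = sigma n p + sigma n q"
  "sigma n (p * q) = sigma n p * sigma n q"
  "sigma n (Const c) = Const c"
  "sigma n (Var v) = sigma_gen n v"
  by (simp_all add: sigma_def subst_add subst_mult)

end

theory Submission
  imports Defs
begin

text \<open>
  Let \<open>u = x\<^sub>1 y\<^sub>1\<close> and \<open>v = x\<^sub>2 y\<^sub>2\<close>. Bracketing with the invariants \<open>u\<close> and \<open>v\<close> multiplies a
  monomial by a difference of its exponents, so modulo brackets only the \<open>u\<^sup>p v\<^sup>q\<close> survive. The bracket
  of \<open>x\<^sub>1 y\<^sub>2\<close> with \<open>x\<^sub>2 y\<^sub>1 u\<^sup>p v\<^sup>q\<close> is \<open>(p + 1) u\<^sup>p v\<^sup>q\<^sup>+\<^sup>1 - (q + 1) u\<^sup>p\<^sup>+\<^sup>1 v\<^sup>q\<close>, which leaves the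
  powers of \<open>u\<close>, and the bracket of \<open>x\<^sub>1\<^sup>n\<close> with \<open>y\<^sub>1\<^sup>n u\<^sup>j\<close> is a nonzero multiple of \<open>u\<^sup>n\<^sup>+\<^sup>j\<^sup>-\<^sup>1\<close>; hence
  \<open>1, u, \<dots>, u\<^sup>n\<^sup>-\<^sup>2\<close> span.

  They are independent because of the Gaussian integral \<open>\<phi>\<close> with \<open>y\<close> conjugate to \<open>x\<close>, for which
  \<open>\<phi> {f, g} = w(f) \<phi> (f g)\<close> where \<open>w\<close> is the degree in \<open>x\<close> minus the degree in \<open>y\<close>. For invariant
  monomials \<open>w(f)\<close> is a multiple of \<open>n\<close>, and if it is nonzero then \<open>f g\<close> contributes to the integral
  only in degree at least \<open>2 n\<close>. So in degrees \<open>2 d \<le> 2 n - 4\<close> the integral vanishes on brackets,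
  but not on \<open>u\<^sup>d\<close>.
\<close>

subsection \<open>Quotient modules\<close>

lemma quotient_module_simps:
  "carrier (quotient_module M N) = a_rcosets\<^bsub>M\<^esub> N"
  "zero (quotient_module M N) = N"
  "add (quotient_module M N) = set_add M"
  "smult (quotient_module M N) = (\<lambda>c A. \<Union>a\<in>A. N +>\<^bsub>M\<^esub> (c \<odot>\<^bsub>M\<^esub> a))"
  by (simp_all add: quotient_module_def)

text \<open>Negatives stay in \<open>N\<close> because they are multiples by -1; this opens the
  coset calculus of abelian subgroups to submodules.\<close>

lemma submodule_abelian_subgroup:
  assumes "Module.module R M" "submodule R N M"
  shows "abelian_subgroup N M"
proof -
  interpret M: Module.module R M by fact
  interpret N: submodule R N M by fact
  have inv: "\<ominus>\<^bsub>M\<^esub> x \<in> N" if "x \<in> N" for x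
  proof -
    have "\<ominus>\<^bsub>R\<^esub> \<one>\<^bsub>R\<^esub> \<odot>\<^bsub>M\<^esub> x = \<ominus>\<^bsub>M\<^esub> x"
      using that N.subset by (intro M.smult_minus_1) auto
    then show ?thesis
      using N.smult_closed[OF M.R.a_inv_closed[OF M.R.one_closed] that] by (simp only:)
  qed
  have nonempty: "N \<noteq> {}"
    using N.zero_closed by blast
  have "subgroup N (add_monoid M)"
    by (rule M.add.subgroupI)
       (use N.subset nonempty inv in \<open>auto simp flip: a_inv_def\<close>)
  then show ?thesis
    by (intro abelian_subgroupI3 additive_subgroupI M.abelian_group_axioms)
qed

text \<open>Representatives of a coset differ by an element of \<open>N\<close>, and so do their
  multiples by \<open>c\<close>; hence the union in \<open>quotient_module\<close> runs over equal
  cosets.\<close>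

lemma quotient_module_smult_coset:
  assumes "Module.module R M" "submodule R N M" "c \<in> carrier R" "x \<in> carrier M"
  shows "c \<odot>\<^bsub>quotient_module M N\<^esub> (N +>\<^bsub>M\<^esub> x) = N +>\<^bsub>M\<^esub> (c \<odot>\<^bsub>M\<^esub> x)"
proof -
  interpret M: Module.module R M by fact
  interpret N: submodule R N M by fact
  interpret N: abelian_subgroup N M
    by (rule submodule_abelian_subgroup[OF assms(1,2)])
  have "N +>\<^bsub>M\<^esub> (c \<odot>\<^bsub>M\<^esub> a) = N +>\<^bsub>M\<^esub> (c \<odot>\<^bsub>M\<^esub> x)" if a: "a \<in> N +>\<^bsub>M\<^esub> x" for a
  proof -
    obtain h where h: "h \<in> N" "a = h \<oplus>\<^bsub>M\<^esub> x"
      using a by (auto simp: a_r_coset_def')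
    then have "c \<odot>\<^bsub>M\<^esub> a = c \<odot>\<^bsub>M\<^esub> h \<oplus>\<^bsub>M\<^esub> c \<odot>\<^bsub>M\<^esub> x"
      using assms N.subset by (auto simp: M.smult_r_distr)
    then have "c \<odot>\<^bsub>M\<^esub> a \<in> N +>\<^bsub>M\<^esub> (c \<odot>\<^bsub>M\<^esub> x)"
      using assms h by (auto simp: a_r_coset_def')
    then show ?thesis
      using assms by (intro N.a_repr_independence'[symmetric]) auto
  qed
  moreover have "x \<in> N +>\<^bsub>M\<^esub> x"
    by (rule N.a_rcos_self[OF assms(4)])
  ultimately show ?thesis
    unfolding quotient_module_simps by blast
qed

lemma module_quotient_module:
  assumes "Module.module R M" "submodule R N M"
  shows "Module.module R (quotient_module M N)"
proof -
  interpret M: Module.module R M by fact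
  interpret N: abelian_subgroup N M
    by (rule submodule_abelian_subgroup[OF assms])
  let ?Q = "quotient_module M N"
  have carr: "\<exists>x\<in>carrier M. A = N +>\<^bsub>M\<^esub> x" if "A \<in> carrier ?Q" for A
    using that by (auto simp: quotient_module_simps A_RCOSETS_def')
  have coset: "N +>\<^bsub>M\<^esub> x \<in> carrier ?Q" if "x \<in> carrier M" for x
    using that by (auto simp: quotient_module_simps A_RCOSETS_def')
  have add: "(N +>\<^bsub>M\<^esub> x) \<oplus>\<^bsub>?Q\<^esub> (N +>\<^bsub>M\<^esub> y) = N +>\<^bsub>M\<^esub> (x \<oplus>\<^bsub>M\<^esub> y)"
    if "x \<in> carrier M" "y \<in> carrier M" for x y
    using that by (simp add: quotient_module_simps N.a_rcos_sum)
  note smult = quotient_module_smult_coset[OF assms]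
  show ?thesis
  proof (rule Module.module.intro)
    show "abelian_group ?Q"
    proof (rule abelian_groupI)
      have "N = N +>\<^bsub>M\<^esub> \<zero>\<^bsub>M\<^esub>"
        by (simp add: N.a_subset)
      then have zero: "\<zero>\<^bsub>?Q\<^esub> = N +>\<^bsub>M\<^esub> \<zero>\<^bsub>M\<^esub>"
        by (simp add: quotient_module_simps)
      show "\<zero>\<^bsub>?Q\<^esub> \<in> carrier ?Q"
        by (simp add: zero coset)
      fix A assume "A \<in> carrier ?Q"
      then obtain x where x: "x \<in> carrier M" "A = N +>\<^bsub>M\<^esub> x"
        using carr by blast
      then show "\<zero>\<^bsub>?Q\<^esub> \<oplus>\<^bsub>?Q\<^esub> A = A"
        by (simp add: zero add)
      show "\<exists>B\<in>carrier ?Q. B \<oplus>\<^bsub>?Q\<^esub> A = \<zero>\<^bsub>?Q\<^esub>"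
        using x by (intro bexI[of _ "N +>\<^bsub>M\<^esub> (\<ominus>\<^bsub>M\<^esub> x)"]) (auto simp: zero add coset M.l_neg)
    qed (auto dest!: carr simp: add coset M.a_ac)
    show "module_axioms R ?Q"
      unfolding module_axioms_def
      by (auto dest!: carr simp: smult add coset M.smult_l_distr M.smult_r_distr M.smult_assoc1)
  qed (rule M.R.is_cring)
qed

lemma coset_module_hom:
  assumes "Module.module R M" "submodule R N M"
  shows "(\<lambda>x. N +>\<^bsub>M\<^esub> x) \<in> module_hom R M (quotient_module M N)"
proof -
  interpret N: abelian_subgroup N M
    by (rule submodule_abelian_subgroup[OF assms])
  show ?thesis
    unfolding module_hom_def
    by (auto simp: quotient_module_smult_coset[OF assms])
       (auto simp: quotient_module_simps A_RCOSETS_def' N.a_rcos_sum)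
qed

subsection \<open>Monomials and invariants\<close>

definition mon :: "nat \<Rightarrow> nat \<Rightarrow> nat \<Rightarrow> nat \<Rightarrow> monom" where
  "mon a1 a2 b1 b2 = Poly_Mapping.single X1 a1 + Poly_Mapping.single X2 a2 +
     Poly_Mapping.single Y1 b1 + Poly_Mapping.single Y2 b2"

lemma lookup_mon [simp]:
  "Poly_Mapping.lookup (mon a1 a2 b1 b2) X1 = a1"
  "Poly_Mapping.lookup (mon a1 a2 b1 b2) X2 = a2"
  "Poly_Mapping.lookup (mon a1 a2 b1 b2) Y1 = b1"
  "Poly_Mapping.lookup (mon a1 a2 b1 b2) Y2 = b2"
  by (simp_all add: mon_def lookup_add lookup_single)

lemma monom_eqI:
  assumes "Poly_Mapping.lookup m X1 = Poly_Mapping.lookup m' X1"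
    "Poly_Mapping.lookup m X2 = Poly_Mapping.lookup m' X2"
    "Poly_Mapping.lookup m Y1 = Poly_Mapping.lookup m' Y1"
    "Poly_Mapping.lookup m Y2 = Poly_Mapping.lookup m' Y2"
  shows "m = (m' :: monom)"
proof (rule poly_mapping_eqI)
  show "Poly_Mapping.lookup m v = Poly_Mapping.lookup m' v" for v
    using assms by (cases v) simp_all
qed

lemma monom_cases:
  obtains a1 a2 b1 b2 where "m = mon a1 a2 b1 b2"
proof
  show "m = mon (Poly_Mapping.lookup m X1) (Poly_Mapping.lookup m X2)
      (Poly_Mapping.lookup m Y1) (Poly_Mapping.lookup m Y2)"
    by (rule monom_eqI) simp_all
qed

lemma mon_eq_iff [simp]:
  "mon a1 a2 b1 b2 = mon a1' a2' b1' b2' \<longleftrightarrow> a1 = a1' \<and> a2 = a2' \<and> b1 = b1' \<and> b2 = b2'"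
proof
  assume "mon a1 a2 b1 b2 = mon a1' a2' b1' b2'"
  then have "Poly_Mapping.lookup (mon a1 a2 b1 b2) v = Poly_Mapping.lookup (mon a1' a2' b1' b2') v" for v
    by simp
  from this[of X1] this[of X2] this[of Y1] this[of Y2]
  show "a1 = a1' \<and> a2 = a2' \<and> b1 = b1' \<and> b2 = b2'"
    by simp
qed simp

lemma mon_add [simp]:
  "mon a1 a2 b1 b2 + mon a1' a2' b1' b2' = mon (a1 + a1') (a2 + a2') (b1 + b1') (b2 + b2')"
  by (rule monom_eqI) (simp_all add: lookup_add)

lemma mon_minus_single:
  "mon a1 a2 b1 b2 - Poly_Mapping.single X1 k = mon (a1 - k) a2 b1 b2"
  "mon a1 a2 b1 b2 - Poly_Mapping.single X2 k = mon a1 (a2 - k) b1 b2"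
  "mon a1 a2 b1 b2 - Poly_Mapping.single Y1 k = mon a1 a2 (b1 - k) b2"
  "mon a1 a2 b1 b2 - Poly_Mapping.single Y2 k = mon a1 a2 b1 (b2 - k)"
  by (rule monom_eqI; simp add: lookup_minus lookup_single)+

lemma partial_mon [simp]:
  "partial X1 (Poly_Mapping.single (mon a1 a2 b1 b2) c) = Poly_Mapping.single (mon (a1 - 1) a2 b1 b2) (of_nat a1 * c)"
  "partial X2 (Poly_Mapping.single (mon a1 a2 b1 b2) c) = Poly_Mapping.single (mon a1 (a2 - 1) b1 b2) (of_nat a2 * c)"
  "partial Y1 (Poly_Mapping.single (mon a1 a2 b1 b2) c) = Poly_Mapping.single (mon a1 a2 (b1 - 1) b2) (of_nat b1 * c)"
  "partial Y2 (Poly_Mapping.single (mon a1 a2 b1 b2) c) = Poly_Mapping.single (mon a1 a2 b1 (b2 - 1)) (of_nat b2 * c)"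
  by (simp_all only: partial_single mon_minus_single lookup_mon)

text \<open>The function \<open>w\<close> of the overview. As \<open>zeta n ^ (n - 1)\<close>
  inverts \<open>zeta n\<close>, this is the exponent by which \<open>sigma n\<close> scales a
  monomial.\<close>

definition weight :: "monom \<Rightarrow> int" where
  "weight m = int (Poly_Mapping.lookup m X1) + int (Poly_Mapping.lookup m X2)
     - int (Poly_Mapping.lookup m Y1) - int (Poly_Mapping.lookup m Y2)"

lemma weight_mon [simp]: "weight (mon a1 a2 b1 b2) = int a1 + int a2 - int b1 - int b2"
  by (simp add: weight_def)

lemma single_eq_Var_power:
  "Poly_Mapping.single m c = Const c * (\<Prod>v\<in>UNIV. Var v ^ Poly_Mapping.lookup m v)"
  using subst_single[of Var m c] by (simp add: subst_id)

text \<open>The eigenvalue of \<open>sigma n\<close> on the monomial \<open>m\<close>.\<close>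

definition sigma_char :: "nat \<Rightarrow> monom \<Rightarrow> complex" where
  "sigma_char n m = zeta n ^ (Poly_Mapping.lookup m X1 + Poly_Mapping.lookup m X2)
     * (zeta n ^ (n - 1)) ^ (Poly_Mapping.lookup m Y1 + Poly_Mapping.lookup m Y2)"

lemma sigma_single:
  "sigma n (Poly_Mapping.single m c) = Poly_Mapping.single m (sigma_char n m * c)"
proof -
  have Const_power: "Const a ^ k = Const (a ^ k)" for a k
    by (induction k) simp_all
  show ?thesis
    unfolding sigma_def subst_single single_eq_Var_power[of m "_ * c"] sigma_char_def
    by (simp add: coord_UNIV power_mult_distrib Const_power power_add mult_ac)
qed

lemma lookup_sigma:
  "Poly_Mapping.lookup (sigma n p) m = sigma_char n m * Poly_Mapping.lookup p m"
proof (induction p rule: S_induct)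
  case (single m' c)
  show ?case by (simp add: sigma_single lookup_single when_def)
next
  case (add p q)
  then show ?case by (simp add: sigma_alg_hom lookup_add algebra_simps)
qed

lemma sigma_char_eq_1_iff:
  assumes "n > 0"
  shows "sigma_char n m = 1 \<longleftrightarrow> int n dvd weight m"
proof -
  obtain a1 a2 b1 b2 where m: "m = mon a1 a2 b1 b2"
    by (rule monom_cases)
  let ?k = "a1 + a2 + (n - 1) * (b1 + b2)"
  have "sigma_char n m = zeta n ^ ?k"
    by (simp only: m sigma_char_def lookup_mon power_add power_mult)
  \<comment> \<open>Since n - 1 is -1 modulo n, the exponent agrees with the weight modulo
    n.\<close>
  moreover have "int ?k = weight m + int n * (int b1 + int b2)"
    unfolding m weight_mon of_nat_add of_nat_mult of_nat_diff[OF Suc_leI[OF assms], folded One_nat_def]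
    by (simp add: algebra_simps)
  then have "int n dvd int ?k \<longleftrightarrow> int n dvd weight m"
    by (simp only: dvd_add_times_triv_right_iff dvd_add_left_iff dvd_triv_left)
  ultimately show ?thesis
    using assms by (simp only: zeta_power_eq_1_iff int_dvd_int_iff)
qed

lemma S_inv_iff_sigma:
  assumes "n \<ge> 2"
  shows "p \<in> S_inv n \<longleftrightarrow> sigma n p = p"
proof
  assume "p \<in> S_inv n"
  moreover have "sigma n ^^ 1 \<in> group_G n"
    unfolding group_G_eq[OF order.strict_trans2[OF pos2 assms]] using assms by (intro imageI) simp
  ultimately show "sigma n p = p"
    by (simp add: S_inv_def)
next
  assume *: "sigma n p = p"
  have "(sigma n ^^ k) p = p" for k
    by (induction k) (simp_all add: *)
  then show "p \<in> S_inv n"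
    using assms by (auto simp: S_inv_def group_G_eq)
qed

text \<open>\<open>sigma n\<close> is diagonal in the monomial basis, so invariance is a condition
  on each monomial separately.\<close>

lemma S_inv_iff_weight:
  assumes "n \<ge> 2"
  shows "p \<in> S_inv n \<longleftrightarrow> (\<forall>m\<in>Poly_Mapping.keys p. int n dvd weight m)"
  using assms
  by (auto simp: S_inv_iff_sigma poly_mapping_eq_iff fun_eq_iff lookup_sigma in_keys_iff
      simp flip: sigma_char_eq_1_iff)

lemma sigma_zero: "sigma n 0 = 0"
  using sigma_alg_hom(3)[of n 0] by simp

text \<open>Chain rule for a diagonal substitution: only the eigenvalue of the variable
  \<open>v\<close> comes out.\<close>

lemma partial_sigma:
  "partial v (sigma n p) = Const (if v \<in> {X1, X2} then zeta n else zeta n ^ (n - 1)) * sigma n (partial v p)"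
proof (induction p rule: S_induct)
  case (single m c)
  obtain a1 a2 b1 b2 where m: "m = mon a1 a2 b1 b2"
    by (rule monom_cases)
  show ?case
    by (cases v; cases "Poly_Mapping.lookup m v")
       (simp_all add: m sigma_single sigma_char_def Const_def mult_single sigma_zero mult_ac)
next
  case (add p q)
  then show ?case by (simp add: sigma_alg_hom partial_add algebra_simps)
qed

text \<open>The factors of \<open>x_i\<close> and \<open>y_i\<close> are inverse to each other and
  cancel in every product of the bracket. This is why brackets of invariants are invariant.\<close>

lemma poisson_sigma:
  assumes "n \<ge> 2"
  shows "poisson (sigma n p) (sigma n q) = sigma n (poisson p q)"
proof -
  have "zeta n * zeta n ^ (n - 1) = 1"
    using assms zeta_power_eq_1_iff[of n n] by (simp flip: power_Suc)
  then have z: "Const (zeta n) * Const (zeta n ^ (n - 1)) = 1"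
    by (simp flip: Const_simps(4))
  have diff: "sigma n (p - q) = sigma n p - sigma n q" for p q
    using sigma_alg_hom(1)[of n "p - q" q] by (simp add: eq_diff_eq)
  have *: "(Const (zeta n) * a) * (Const (zeta n ^ (n - 1)) * b) = a * b"
    "(Const (zeta n ^ (n - 1)) * a) * (Const (zeta n) * b) = a * b" for a b
  proof -
    have "(Const (zeta n) * a) * (Const (zeta n ^ (n - 1)) * b) =
        (Const (zeta n) * Const (zeta n ^ (n - 1))) * (a * b)"
      by (simp only: mult_ac)
    then show "(Const (zeta n) * a) * (Const (zeta n ^ (n - 1)) * b) = a * b"
      by (simp only: z mult_1)
    have "(Const (zeta n ^ (n - 1)) * a) * (Const (zeta n) * b) =
        (Const (zeta n) * Const (zeta n ^ (n - 1))) * (a * b)"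
      by (simp only: mult_ac)
    then show "(Const (zeta n ^ (n - 1)) * a) * (Const (zeta n) * b) = a * b"
      by (simp only: z mult_1)
  qed
  show ?thesis
    unfolding poisson_def partial_sigma sigma_alg_hom diff
    by (simp only: insert_iff coord.distinct empty_iff simp_thms if_True if_False *)
qed

lemma S_inv_closed:
  assumes "n \<ge> 2"
  shows "0 \<in> S_inv n"
    "p \<in> S_inv n \<Longrightarrow> q \<in> S_inv n \<Longrightarrow> p + q \<in> S_inv n"
    "p \<in> S_inv n \<Longrightarrow> Const c * p \<in> S_inv n"
    "p \<in> S_inv n \<Longrightarrow> q \<in> S_inv n \<Longrightarrow> poisson p q \<in> S_inv n"
  using sigma_alg_hom(3)[of n 0] poisson_sigma[OF assms, of p q]
  by (auto simp: S_inv_iff_sigma[OF assms] sigma_alg_hom)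

lemma S_inv_single:
  assumes "n \<ge> 2" "int n dvd weight m"
  shows "Poly_Mapping.single m c \<in> S_inv n"
  using assms by (auto simp: S_inv_iff_weight)

lemma poly_mapping_sum_singles:
  "p = (\<Sum>m\<in>Poly_Mapping.keys p. Poly_Mapping.single m (Poly_Mapping.lookup p m))"
  by (rule poly_mapping_eqI)
     (auto simp: lookup_sum lookup_single when_def in_keys_iff sum.delta')

text \<open>Each monomial summand of an invariant polynomial is itself invariant, so additive claims
  about invariants reduce to invariant monomials.\<close>

lemma S_inv_induct [consumes 2, case_names single zero add]:
  assumes "n \<ge> 2" "p \<in> S_inv n"
    and single: "\<And>m c. int n dvd weight m \<Longrightarrow> P (Poly_Mapping.single m c)"
    and zero: "P 0"
    and add: "\<And>p q. P p \<Longrightarrow> P q \<Longrightarrow> P (p + q)"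
  shows "P p"
proof -
  have "P (\<Sum>m\<in>A. Poly_Mapping.single m (Poly_Mapping.lookup p m))" if "A \<subseteq> Poly_Mapping.keys p" for A
    using finite_subset[OF that finite_keys] that
  proof (induction A rule: finite_induct)
    case (insert m A)
    then show ?case
      using assms(1,2) by (auto simp: S_inv_iff_weight intro!: single add)
  qed (simp add: zero)
  from this[OF order_refl] show ?thesis
    by (simp flip: poly_mapping_sum_singles)
qed

subsection \<open>The Gaussian functional\<close>

text \<open>Up to normalisation, the part of degree \<open>2 d\<close> of the Gaussian integral
  \<open>\<integral> p(z, cnj z) exp (- \<bar>z\<bar>\<^sup>2)\<close> over \<open>\<complex>\<^sup>2\<close>, which sends \<open>x\<^sup>a y\<^sup>b\<close> to \<open>a!\<close> if \<open>a = b\<close> and to \<open>0\<close>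
  otherwise.\<close>

definition gauss :: "nat \<Rightarrow> S \<Rightarrow> complex" where
  "gauss d p = (\<Sum>i\<le>d. fact i * fact (d - i) * Poly_Mapping.lookup p (mon i (d - i) i (d - i)))"

lemma gauss_linear:
  "gauss d 0 = 0"
  "gauss d (p + q) = gauss d p + gauss d q"
  "gauss d (p - q) = gauss d p - gauss d q"
  "gauss d (Const c * p) = c * gauss d p"
proof -
  have "Poly_Mapping.lookup (Const c * p) m = c * Poly_Mapping.lookup p m" for m
  proof (induction p rule: S_induct)
    case (single m' a)
    show ?case by (simp add: Const_def mult_single lookup_single when_def)
  next
    case (add p q)
    then show ?case by (simp add: lookup_add algebra_simps)
  qed
  then show "gauss d (Const c * p) = c * gauss d p"
    by (simp add: gauss_def sum_distrib_left mult_ac)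
qed (simp_all add: gauss_def lookup_add lookup_minus sum.distrib sum_subtractf algebra_simps)

lemma gauss_sum: "gauss d (\<Sum>i\<in>I. f i) = (\<Sum>i\<in>I. gauss d (f i))"
  by (induction I rule: infinite_finite_induct) (simp_all add: gauss_linear)

lemma gauss_single:
  "gauss d (Poly_Mapping.single (mon a1 a2 b1 b2) c) =
     (if a1 = b1 \<and> a2 = b2 \<and> a1 + a2 = d then fact a1 * fact a2 * c else 0)"
proof (cases "a1 = b1 \<and> a2 = b2 \<and> a1 + a2 = d")
  case True
  have "gauss d (Poly_Mapping.single (mon a1 a2 b1 b2) c) =
      (\<Sum>i\<le>d. if i = a1 then fact a1 * fact a2 * c else 0)"
    unfolding gauss_def by (rule sum.cong) (use True in \<open>auto simp: lookup_single when_def\<close>)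
  then show ?thesis
    using True by auto
next
  case False
  then show ?thesis
    unfolding gauss_def by (intro trans[OF sum.neutral]) (auto simp: lookup_single when_def)
qed

text \<open>Integration by parts replaces \<open>\<partial>/\<partial>y\<^sub>i\<close> by multiplication with \<open>x\<^sub>i\<close> and vice versa, so
  that the bracket with \<open>m\<close> becomes the Euler field \<open>\<Sum> x\<^sub>i \<partial>/\<partial>x\<^sub>i - y\<^sub>i \<partial>/\<partial>y\<^sub>i\<close> applied to \<open>m\<close>.\<close>

lemma gauss_poisson_single:
  "gauss d (poisson (Poly_Mapping.single m a) (Poly_Mapping.single m' b)) =
     of_int (weight m) * gauss (Suc d) (Poly_Mapping.single m a * Poly_Mapping.single m' b)"
proof -
  obtain a1 a2 b1 b2 where m: "m = mon a1 a2 b1 b2"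
    by (rule monom_cases)
  obtain a1' a2' b1' b2' where m': "m' = mon a1' a2' b1' b2'"
    by (rule monom_cases)
  \<comment> \<open>\<open>r1\<close> and \<open>r2\<close> are the exponents of \<open>x1\<close>
    and \<open>x2\<close> in the product; \<open>B\<close> says that the product is balanced with
    degree d + 1 in \<open>x\<close>, which is when it contributes.\<close>
  define r1 r2 where "r1 = a1 + a1'" and "r2 = a2 + a2'"
  define B where "B \<longleftrightarrow> a1 + a1' = b1 + b1' \<and> a2 + a2' = b2 + b2' \<and> a1 + a1' + (a2 + a2') = Suc d"
  \<comment> \<open>A zero among the differentiated exponents makes both sides vanish; otherwise
    subtracting 1 is exact.\<close>
  have g: "gauss d (partial X1 (Poly_Mapping.single m a) * partial Y1 (Poly_Mapping.single m' b)) =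
      (if B then of_nat a1 * of_nat b1' * fact (r1 - 1) * fact r2 * a * b else 0)"
    "gauss d (partial Y1 (Poly_Mapping.single m a) * partial X1 (Poly_Mapping.single m' b)) =
      (if B then of_nat b1 * of_nat a1' * fact (r1 - 1) * fact r2 * a * b else 0)"
    "gauss d (partial X2 (Poly_Mapping.single m a) * partial Y2 (Poly_Mapping.single m' b)) =
      (if B then of_nat a2 * of_nat b2' * fact r1 * fact (r2 - 1) * a * b else 0)"
    "gauss d (partial Y2 (Poly_Mapping.single m a) * partial X2 (Poly_Mapping.single m' b)) =
      (if B then of_nat b2 * of_nat a2' * fact r1 * fact (r2 - 1) * a * b else 0)"
    unfolding m m' r1_def r2_def B_def
    subgoal by (cases a1; cases b1') (auto simp: mult_single gauss_single gauss_linear)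
    subgoal by (cases b1; cases a1') (auto simp: mult_single gauss_single gauss_linear)
    subgoal by (cases a2; cases b2') (auto simp: mult_single gauss_single gauss_linear)
    subgoal by (cases b2; cases a2') (auto simp: mult_single gauss_single gauss_linear)
    done
  have rhs: "gauss (Suc d) (Poly_Mapping.single m a * Poly_Mapping.single m' b) =
      (if B then fact r1 * fact r2 * (a * b) else 0)"
    by (auto simp: m m' mult_single gauss_single r1_def r2_def B_def)
  show ?thesis
  proof (cases B)
    case False
    then show ?thesis
      unfolding poisson_def gauss_linear g rhs by simp
  next
    case True
    then have "r1 = b1 + b1'" "r2 = b2 + b2'" "r1 = a1 + a1'" "r2 = a2 + a2'"
      unfolding B_def r1_def r2_def by auto
    \<comment> \<open>Eliminating the primed exponents turns \<open>a1 * b1' - b1 * a1'\<close> into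
      \<open>r1 * (a1 - b1)\<close>, and likewise for the second pair.\<close>
    then have r: "of_nat b1' = of_nat r1 - (of_nat b1 :: complex)" "of_nat b2' = of_nat r2 - (of_nat b2 :: complex)"
      "of_nat a1' = of_nat r1 - (of_nat a1 :: complex)" "of_nat a2' = of_nat r2 - (of_nat a2 :: complex)"
      by (simp_all add: eq_diff_eq flip: of_nat_add)
    \<comment> \<open>The recursion r1 (r1 - 1)! = r1! fails for r1 = 0, but then a1 = b1 =
      0.\<close>
    have f1: "of_nat r1 * fact (r1 - 1) * (of_nat a1 - of_nat b1) = fact r1 * (of_nat a1 - of_nat b1 :: complex)"
    proof (cases "r1 = 0")
      case True
      then show ?thesis
        using \<open>r1 = a1 + a1'\<close> \<open>r1 = b1 + b1'\<close> by simp
    next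
      case False
      then show ?thesis
        by (simp only: fact_reduce[of r1] neq0_conv)
    qed
    have f2: "of_nat r2 * fact (r2 - 1) * (of_nat a2 - of_nat b2) = fact r2 * (of_nat a2 - of_nat b2 :: complex)"
    proof (cases "r2 = 0")
      case True
      then show ?thesis
        using \<open>r2 = a2 + a2'\<close> \<open>r2 = b2 + b2'\<close> by simp
    next
      case False
      then show ?thesis
        by (simp only: fact_reduce[of r2] neq0_conv)
    qed
    have "gauss d (poisson (Poly_Mapping.single m a) (Poly_Mapping.single m' b)) =
        (of_nat r1 * fact (r1 - 1) * (of_nat a1 - of_nat b1)) * (fact r2 * a * b) +
        (of_nat r2 * fact (r2 - 1) * (of_nat a2 - of_nat b2)) * (fact r1 * a * b)"
      unfolding poisson_def gauss_linear g if_P[OF True] r by (simp only: algebra_simps)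
    also have "\<dots> = of_int (weight m) * (fact r1 * fact r2 * (a * b))"
      unfolding f1 f2 by (simp add: m algebra_simps)
    finally show ?thesis
      unfolding rhs if_P[OF True] .
  qed
qed

lemma poisson_add_left: "poisson (p + q) r = poisson p r + poisson q r"
  using poisson_add[of r p q] by (simp add: poisson_antisym[of _ r])

lemma poisson_zero [simp]: "poisson p 0 = 0" "poisson 0 p = 0"
  using poisson_add[of p 0 0] poisson_add_left[of 0 0 p] by simp_all

text \<open>A nonzero weight of \<open>m\<close> is a multiple of n, so \<open>m\<close> has at
  least n factors \<open>x\<close> or n factors \<open>y\<close>; a product seen by
  \<open>gauss (Suc d)\<close> has only d + 1 < n of each.\<close>

lemma gauss_poisson_S_inv:
  assumes n: "n \<ge> 2" and d: "Suc d < n" and f: "f \<in> S_inv n" and g: "g \<in> S_inv n"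
  shows "gauss d (poisson f g) = 0"
  using n f
proof (induction f rule: S_inv_induct)
  case f: (single m a)
  show ?case
    using n g
  proof (induction g rule: S_inv_induct)
    case g: (single m' b)
    obtain a1 a2 b1 b2 where m: "m = mon a1 a2 b1 b2"
      by (rule monom_cases)
    obtain a1' a2' b1' b2' where m': "m' = mon a1' a2' b1' b2'"
      by (rule monom_cases)
    have "weight m = 0" if "gauss (Suc d) (Poly_Mapping.single m a * Poly_Mapping.single m' b) \<noteq> 0"
    proof (rule ccontr)
      assume "weight m \<noteq> 0"
      then have "int n \<le> \<bar>weight m\<bar>"
        using f by (metis abs_dvd_iff dvd_abs_iff zdvd_imp_le zero_less_abs_iff)
      moreover have "a1 + a1' + (a2 + a2') = Suc d" "b1 + b1' + (b2 + b2') = Suc d"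
        using that by (auto simp: m m' mult_single gauss_single split: if_splits)
      then have "\<bar>weight m\<bar> \<le> int (Suc d)"
        by (simp add: m)
      ultimately show False
        using d by simp
    qed
    then show ?case
      by (auto simp: gauss_poisson_single)
  qed (simp_all add: gauss_linear poisson_add)
qed (simp_all add: gauss_linear poisson_add_left)

section \<open>Invariants and brackets as complex vector spaces\<close>

lemma S_space_simps:
  "carrier S_space = UNIV" "zero S_space = 0" "add S_space = (+)"
  "smult S_space = (\<lambda>c p. Const c * p)"
  by (simp_all add: S_space_def)

lemma module_S_space: "Module.module class_ring S_space"
  by (rule module_criteria)
     (auto simp: S_space_simps class_ring_simps algebra_simps intro!: exI[of _ "- _"] domain.axioms(1) field.axioms(1) VS_Connect.class_field)

lemma module_S_inv_space:
  assumes "n \<ge> 2"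
  shows "Module.module class_ring (S_inv_space n)"
proof -
  have "LinearCombinations.submodule class_ring (S_inv n) S_space"
    by (rule LinearCombinations.submodule.intro)
       (auto simp: S_space_simps module_S_space S_inv_closed[OF assms])
  then show ?thesis
    by (rule module.submodule_is_module[OF module_S_space])
qed

lemma submodule_brackets:
  assumes "n \<ge> 2"
  shows "LinearCombinations.submodule class_ring (brackets n) (S_inv_space n)"
  unfolding brackets_def
  by (rule module.span_is_submodule[OF module_S_inv_space[OF assms]])
     (auto simp: S_inv_closed[OF assms])

lemma brackets_closed:
  assumes "n \<ge> 2"
  shows "0 \<in> brackets n"
    "p \<in> brackets n \<Longrightarrow> q \<in> brackets n \<Longrightarrow> p + q \<in> brackets n"
    "p \<in> brackets n \<Longrightarrow> Const c * p \<in> brackets n"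
    "f \<in> S_inv n \<Longrightarrow> g \<in> S_inv n \<Longrightarrow> poisson f g \<in> brackets n"
proof -
  interpret N: LinearCombinations.submodule class_ring "brackets n" "S_inv_space n"
    by (rule submodule_brackets[OF assms])
  show "0 \<in> brackets n"
    "p \<in> brackets n \<Longrightarrow> q \<in> brackets n \<Longrightarrow> p + q \<in> brackets n"
    "p \<in> brackets n \<Longrightarrow> Const c * p \<in> brackets n"
    using N.zero_closed N.m_closed[of p q] N.smult_closed[of c p]
    by (auto simp: S_space_simps class_ring_simps)
  show "f \<in> S_inv n \<Longrightarrow> g \<in> S_inv n \<Longrightarrow> poisson f g \<in> brackets n"
    unfolding brackets_def
    by (rule subsetD[OF module.in_own_span[OF module_S_inv_space[OF assms]]])
       (use S_inv_closed(4)[OF assms] in auto)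
qed

lemma gauss_brackets:
  assumes n: "n \<ge> 2" and d: "Suc d < n" and p: "p \<in> brackets n"
  shows "gauss d p = 0"
proof -
  \<comment> \<open>The kernel of \<open>gauss d\<close> on the invariants is a subspace containing
    all brackets, hence contains their span.\<close>
  have "LinearCombinations.submodule class_ring {p \<in> S_inv n. gauss d p = 0} (S_inv_space n)"
    by (rule LinearCombinations.submodule.intro)
       (auto simp: S_space_simps module_S_inv_space n S_inv_closed gauss_linear)
  moreover have "{poisson f g | f g. f \<in> S_inv n \<and> g \<in> S_inv n} \<subseteq> {p \<in> S_inv n. gauss d p = 0}"
    using S_inv_closed(4)[OF n] gauss_poisson_S_inv[OF n d] by blast
  ultimately have "brackets n \<subseteq> {p \<in> S_inv n. gauss d p = 0}"
    unfolding brackets_def by (intro module.span_is_subset[OF module_S_inv_space[OF n]])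
  then show ?thesis
    using p by auto
qed

subsection \<open>Spanning by powers of \<open>x\<^sub>1 y\<^sub>1\<close>\<close>

lemma poisson_mon:
  "poisson (Poly_Mapping.single (mon a1 a2 b1 b2) a) (Poly_Mapping.single (mon a1' a2' b1' b2') b) =
     Poly_Mapping.single (mon (a1 - 1 + a1') (a2 + a2') (b1 + (b1' - 1)) (b2 + b2')) (of_nat a1 * a * (of_nat b1' * b)) -
     Poly_Mapping.single (mon (a1 + (a1' - 1)) (a2 + a2') (b1 - 1 + b1') (b2 + b2')) (of_nat b1 * a * (of_nat a1' * b)) +
     (Poly_Mapping.single (mon (a1 + a1') (a2 - 1 + a2') (b1 + b1') (b2 + (b2' - 1))) (of_nat a2 * a * (of_nat b2' * b)) -
      Poly_Mapping.single (mon (a1 + a1') (a2 + (a2' - 1)) (b1 + b1') (b2 - 1 + b2')) (of_nat b2 * a * (of_nat a2' * b)))"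
  by (simp only: poisson_def partial_mon mult_single mon_add)

text \<open>The brackets of \<open>x1 y1\<close> and \<open>x2 y2\<close> with the monomial are its
  multiples by b1 - a1 and b2 - a2, one of which can be divided out.\<close>

lemma single_unbalanced_in_brackets:
  assumes n: "n \<ge> 2" and m: "int n dvd weight (mon a1 a2 b1 b2)" and ne: "a1 \<noteq> b1 \<or> a2 \<noteq> b2"
  shows "Poly_Mapping.single (mon a1 a2 b1 b2) c \<in> brackets n"
proof -
  have inv: "Poly_Mapping.single (mon a1 a2 b1 b2) c \<in> S_inv n"
    "Poly_Mapping.single (mon 1 0 1 0) c \<in> S_inv n" "Poly_Mapping.single (mon 0 1 0 1) c \<in> S_inv n" for c
    using m by (simp_all add: S_inv_single[OF n])
  have 1: "poisson (Poly_Mapping.single (mon 1 0 1 0) 1) (Poly_Mapping.single (mon a1 a2 b1 b2) c') =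
      Poly_Mapping.single (mon a1 a2 b1 b2) ((of_nat b1 - of_nat a1) * c')" for c'
    unfolding poisson_mon by (cases a1; cases b1) (simp_all add: algebra_simps flip: single_diff single_add single_uminus)
  have 2: "poisson (Poly_Mapping.single (mon 0 1 0 1) 1) (Poly_Mapping.single (mon a1 a2 b1 b2) c') =
      Poly_Mapping.single (mon a1 a2 b1 b2) ((of_nat b2 - of_nat a2) * c')" for c'
    unfolding poisson_mon by (cases a2; cases b2) (simp_all add: algebra_simps flip: single_diff single_add single_uminus)
  show ?thesis
  proof (cases "a1 = b1")
    case False
    then show ?thesis
      using brackets_closed(4)[OF n inv(2,1), of 1 "c / (of_nat b1 - of_nat a1)"] unfolding 1 by simp
  next
    case True
    then show ?thesis
      using ne brackets_closed(4)[OF n inv(3,1), of 1 "c / (of_nat b2 - of_nat a2)"] unfolding 2 by simp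
  qed
qed

text \<open>Trades a factor \<open>x2 y2\<close> for a factor \<open>x1 y1\<close> up to a scalar.
  The relation is the bracket of \<open>x1 y2\<close> with
  \<open>x1^p x2^(q+1) y1^(p+1) y2^q\<close>, both of weight 0.\<close>

lemma exchange_in_brackets:
  assumes n: "n \<ge> 2"
  shows "Poly_Mapping.single (mon p (Suc q) p (Suc q)) (of_nat (Suc p) * c) -
     Poly_Mapping.single (mon (Suc p) q (Suc p) q) (of_nat (Suc q) * c) \<in> brackets n"
proof -
  have "poisson (Poly_Mapping.single (mon 1 0 0 1) 1) (Poly_Mapping.single (mon p (Suc q) (Suc p) q) c) \<in> brackets n"
    by (intro brackets_closed(4) n S_inv_single) simp_all
  then show ?thesis
    unfolding poisson_mon by simp
qed

lemma high_power_in_brackets: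
  assumes n: "n \<ge> 2" and p: "n \<le> Suc p"
  shows "Poly_Mapping.single (mon p 0 p 0) c \<in> brackets n"
proof -
  \<comment> \<open>Chosen so that the bracket of \<open>x1^n\<close> with
    \<open>x1^j y1^(n+j)\<close> has exponent n - 1 + j = p; the arguments have weights n and
    -n.\<close>
  define j where "j = Suc p - n"
  have j: "n + j = Suc p"
    using p by (simp add: j_def)
  have "n - 1 + j = p"
    using j n by simp
  then have "poisson (Poly_Mapping.single (mon n 0 0 0) 1) (Poly_Mapping.single (mon j 0 (n + j) 0) c') =
      Poly_Mapping.single (mon p 0 p 0) (of_nat n * (of_nat (Suc p) * c'))" for c'
    unfolding poisson_mon j by (simp del: of_nat_Suc)
  moreover have "poisson (Poly_Mapping.single (mon n 0 0 0) 1)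
      (Poly_Mapping.single (mon j 0 (n + j) 0) (c / (of_nat n * of_nat (Suc p)))) \<in> brackets n"
    by (intro brackets_closed(4) n S_inv_single) simp_all
  moreover have "of_nat n * (of_nat (Suc p) * (c / (of_nat n * of_nat (Suc p)))) = c"
    using n by (simp del: of_nat_Suc)
  ultimately show ?thesis
    by (simp only:)
qed

text \<open>The candidate representatives, used with k = n - 1: combinations of powers of
  \<open>x1 y1\<close>. Values of \<open>a\<close> from k on are ignored.\<close>

definition reps :: "nat \<Rightarrow> (nat \<Rightarrow> complex) \<Rightarrow> S" where
  "reps k a = (\<Sum>d<k. Poly_Mapping.single (mon d 0 d 0) (a d))"

lemma reps_add: "reps k (\<lambda>d. a d + b d) = reps k a + reps k b"
  by (simp add: reps_def single_add sum.distrib)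

lemma reps_smult: "reps k (\<lambda>d. c * a d) = Const c * reps k a"
  by (simp add: reps_def sum_distrib_left Const_def mult_single)

lemma reps_in_S_inv:
  assumes "n \<ge> 2"
  shows "reps k a \<in> S_inv n"
  unfolding reps_def
  by (induction k) (simp_all add: S_inv_closed[OF assms] S_inv_single[OF assms])

text \<open>Up to d!, \<open>gauss d\<close> is the d-th coordinate, which makes the low powers
  independent modulo brackets.\<close>

lemma gauss_reps:
  assumes "d < k"
  shows "gauss d (reps k a) = fact d * a d"
proof -
  have "gauss d (reps k a) = (\<Sum>i<k. if i = d then fact d * a d else 0)"
    unfolding reps_def gauss_sum by (rule sum.cong) (auto simp: gauss_single)
  then show ?thesis
    using assms by simp
qed

lemma reps_complete:
  assumes n: "n \<ge> 2" and p: "p \<in> S_inv n"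
  shows "\<exists>a. p - reps (n - 1) a \<in> brackets n"
  using n p
proof (induction p rule: S_inv_induct)
  case zero
  have "reps (n - 1) (\<lambda>_. 0) = 0"
    by (simp add: reps_def)
  then show ?case
    using brackets_closed(1)[OF n] by (metis diff_zero)
next
  case add: (add p q)
  then obtain a b where "p - reps (n - 1) a \<in> brackets n" "q - reps (n - 1) b \<in> brackets n"
    by blast
  from brackets_closed(2)[OF n this] show ?case
    by (intro exI[of _ "\<lambda>d. a d + b d"]) (simp add: reps_add algebra_simps)
next
  case m: (single m c)
  obtain a1 a2 b1 b2 where m': "m = mon a1 a2 b1 b2"
    by (rule monom_cases)
  have in_brackets: ?case if "Poly_Mapping.single m c \<in> brackets n"
    using that by (intro exI[of _ "\<lambda>_. 0"]) (simp add: reps_def)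
  show ?case
  proof (cases "a1 = b1 \<and> a2 = b2")
    case False
    then show ?thesis
      using m by (intro in_brackets) (simp add: m' single_unbalanced_in_brackets[OF n] del: weight_mon)
  next
    case True
    \<comment> \<open>Induction on the exponent of \<open>x2 y2\<close>; \<open>a1\<close> and
      \<open>c\<close> vary because each exchange raises the first and rescales the second.\<close>
    have "\<exists>a. Poly_Mapping.single (mon a1 a2 a1 a2) c - reps (n - 1) a \<in> brackets n"
    proof (induction a2 arbitrary: a1 c)
      case 0
      \<comment> \<open>Powers from n - 1 on lie in the span of brackets; the lower ones are
        representatives themselves.\<close>
      show ?case
      proof (cases "n \<le> Suc a1")
        case True
        then show ?thesis
          using high_power_in_brackets[OF n True, of c] by (intro exI[of _ "\<lambda>_. 0"]) (simp add: reps_def)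
      next
        case False
        have "reps (n - 1) (\<lambda>d. if d = a1 then c else 0) =
            (\<Sum>d<n - 1. if d = a1 then Poly_Mapping.single (mon a1 0 a1 0) c else 0)"
          unfolding reps_def by (rule sum.cong) auto
        also have "\<dots> = Poly_Mapping.single (mon a1 0 a1 0) c"
          using False by simp
        finally show ?thesis
          using brackets_closed(1)[OF n] by (metis diff_self)
      qed
    next
      case (Suc q)
      \<comment> \<open>Dividing by a1 + 1 makes the leading coefficient of the exchange relation
        equal to \<open>c\<close>.\<close>
      have "complex_of_nat (Suc a1) \<noteq> 0"
        by (simp del: of_nat_Suc)
      then have "Poly_Mapping.single (mon a1 (Suc q) a1 (Suc q)) c -
          Poly_Mapping.single (mon (Suc a1) q (Suc a1) q) (of_nat (Suc q) * (c / of_nat (Suc a1))) \<in> brackets n"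
        using exchange_in_brackets[OF n, of a1 q "c / of_nat (Suc a1)"] by (simp del: of_nat_Suc)
      moreover obtain a where
        "Poly_Mapping.single (mon (Suc a1) q (Suc a1) q) (of_nat (Suc q) * (c / of_nat (Suc a1)))
           - reps (n - 1) a \<in> brackets n"
        using Suc.IH by blast
      ultimately have "(Poly_Mapping.single (mon a1 (Suc q) a1 (Suc q)) c -
          Poly_Mapping.single (mon (Suc a1) q (Suc a1) q) (of_nat (Suc q) * (c / of_nat (Suc a1)))) +
          (Poly_Mapping.single (mon (Suc a1) q (Suc a1) q) (of_nat (Suc q) * (c / of_nat (Suc a1)))
           - reps (n - 1) a) \<in> brackets n"
        by (rule brackets_closed(2)[OF n])
      then show ?case
        by (intro exI[of _ a]) simp
    qed
    then show ?thesis
      using True by (simp add: m')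
  qed
qed

subsection \<open>The dimension\<close>

theorem mainTheorem2:
  fixes n :: nat
  assumes "n \<ge> 2"
  shows "vectorspace class_ring (HP0 n) \<and>
         vectorspace.fin_dim class_ring (HP0 n) \<and>
         vectorspace.dim class_ring (HP0 n) = n - 1"
proof -
  let ?M = "S_inv_space n" and ?N = "brackets n"
  let ?V = "module_vec TYPE(complex) (n - 1)"
  note M = module_S_inv_space[OF assms] and N = submodule_brackets[OF assms]
  interpret N: abelian_subgroup ?N ?M
    by (rule submodule_abelian_subgroup[OF M N])
  interpret U: vec_space "TYPE(complex)" "n - 1" .
  \<comment> \<open>Sends a coordinate vector to the class of its combination of powers of
    \<open>x1 y1\<close>; \<open>T\<close> turns out to be a linear isomorphism.\<close>
  define T where "T v = ?N +>\<^bsub>?M\<^esub> reps (n - 1) (vec_index v)" for v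
  have carrM: "carrier ?M = S_inv n" "add ?M = (+)" "smult ?M = (\<lambda>c p. Const c * p)"
    by (simp_all add: S_space_simps)
  have reps: "reps (n - 1) a \<in> carrier ?M" for a
    by (simp add: carrM reps_in_S_inv[OF assms])
  have HP0: "vectorspace class_ring (HP0 n)"
    unfolding vectorspace_def HP0_def using module_quotient_module[OF M N] VS_Connect.class_field by blast
  \<comment> \<open>Vector operations determine entries only below the dimension n - 1, so linearity
    of \<open>T\<close> is checked on these alone.\<close>
  have reps_cong: "reps (n - 1) a = reps (n - 1) b" if "\<And>d. d < n - 1 \<Longrightarrow> a d = b d" for a b
    unfolding reps_def using that by (intro sum.cong) auto
  have hom: "(\<lambda>x. ?N +>\<^bsub>?M\<^esub> x) \<in> module_hom class_ring ?M (HP0 n)"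
    unfolding HP0_def by (rule coset_module_hom[OF M N])
  have "T \<in> module_hom class_ring ?V (HP0 n)"
    unfolding module_hom_def
  proof ((intro CollectI conjI allI impI funcsetI; (elim conjE)?), goal_cases)
    case (1 v)
    show ?case
      unfolding T_def by (rule funcset_mem[OF module_hom_closed[OF hom] reps])
  next
    case (2 v w)
    have "reps (n - 1) (vec_index (v + w)) = reps (n - 1) (vec_index v) + reps (n - 1) (vec_index w)"
      unfolding reps_add[symmetric] using 2 by (intro reps_cong) (auto simp: module_vec_simps)
    then show ?case
      unfolding T_def using module_hom_add[OF hom reps reps] by (simp add: carrM module_vec_simps)
  next
    case (3 c v)
    have "reps (n - 1) (vec_index (c \<cdot>\<^sub>v v)) = Const c * reps (n - 1) (vec_index v)"
      unfolding reps_smult[symmetric] using 3 by (intro reps_cong) (auto simp: module_vec_simps)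
    then show ?case
      unfolding T_def using module_hom_smult[OF hom 3(1) reps] by (simp add: carrM module_vec_simps)
  qed
  then interpret T: linear_map class_ring ?V "HP0 n" T
    by (intro linear_map.intro mod_hom.intro mod_hom_axioms.intro vec_vs HP0)
       (use HP0 vec_vs in \<open>auto simp: vectorspace_def\<close>)
  have coset_eq: "?N +>\<^bsub>?M\<^esub> p = ?N +>\<^bsub>?M\<^esub> q" if "p - q \<in> ?N" "q \<in> carrier ?M" for p q
  proof (rule N.a_repr_independence'[symmetric])
    have "p = (p - q) \<oplus>\<^bsub>?M\<^esub> q"
      by (simp add: carrM)
    then show "p \<in> ?N +>\<^bsub>?M\<^esub> q"
      using that(1) unfolding a_r_coset_def' by blast
  qed (rule that(2))
  have "inj_on T (carrier ?V)"
  proof (rule inj_onI)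
    fix v w assume vw: "v \<in> carrier ?V" "w \<in> carrier ?V" and "T v = T w"
    then have "reps (n - 1) (vec_index v) \<in> ?N +>\<^bsub>?M\<^esub> reps (n - 1) (vec_index w)"
      using N.a_rcos_self[OF reps[of "vec_index v"]] by (simp add: T_def)
    then obtain h where h: "h \<in> ?N" "reps (n - 1) (vec_index v) = h + reps (n - 1) (vec_index w)"
      by (auto simp: a_r_coset_def' carrM)
    \<comment> \<open>As d < n - 1 means \<open>Suc d < n\<close>, the functional
      \<open>gauss d\<close> kills \<open>h\<close> and recovers the entry at d.\<close>
    have "vec_index v d = vec_index w d" if "d < n - 1" for d
    proof -
      have "gauss d (reps (n - 1) (vec_index v)) = gauss d (reps (n - 1) (vec_index w))"
        using h gauss_brackets[OF assms _ h(1), of d] that by (simp add: gauss_linear)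
      then show ?thesis
        using that by (simp add: gauss_reps)
    qed
    then show "v = w"
      using vw by (intro eq_vecI) (auto simp: module_vec_simps)
  qed
  moreover have "T ` carrier ?V = carrier (HP0 n)"
  proof
    show "T ` carrier ?V \<subseteq> carrier (HP0 n)"
      by auto
    show "carrier (HP0 n) \<subseteq> T ` carrier ?V"
    proof
      fix A assume "A \<in> carrier (HP0 n)"
      then obtain p where p: "p \<in> S_inv n" "A = ?N +>\<^bsub>?M\<^esub> p"
        by (auto simp: HP0_def quotient_module_simps A_RCOSETS_def' carrM)
      obtain a where "p - reps (n - 1) a \<in> ?N"
        using reps_complete[OF assms p(1)] by blast
      then have "A = ?N +>\<^bsub>?M\<^esub> reps (n - 1) a"
        unfolding p(2) by (rule coset_eq[OF _ reps])
      also have "\<dots> = T (Matrix.vec (n - 1) a)"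
        unfolding T_def by (rule arg_cong[OF reps_cong]) simp
      finally show "A \<in> T ` carrier ?V"
        by (auto simp: module_vec_simps)
    qed
  qed
  ultimately show ?thesis
    using HP0 T.dim_eq[OF U.fin_dim] T.surj_fin_dim[OF U.fin_dim] U.dim_is_n by simp
qed

end
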